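(* For every positive integer $n$, the list packing number of the complete graph $K_n$ satisfies $\chi_{\ell}^*(K_n) = n$.
   Context: All graphs are finite and simple. A list assignment $L$ for a graph $G$ assigns to each vertex $v \in V(G)$ a set $L(v)$ of colors; $L$ is a $k$-assignment if $|L(v)| = k$ for every $v \in V(G)$. An $L$-coloring of $G$ is a function $f$ on $V(G)$ with $f(v) \in L(v)$ for all $v$; it is proper if $f(u) \neq f(v)$ whenever $uv \in E(G)$. An $L$-packing of $G$ of size $k$ is a set of $k$ $L$-colorings $\{f_1, \ldots, f_k\}$ of $G$ such that $f_i(v) \neq f_j(v)$ whenever $i \neq j$ and $v \in V(G)$; it is proper if each $f_i$ is a proper $L$-coloring. The list packing number $\chi_{\ell}^*(G)$ is the least $k$ such that $G$ has a proper $L$-packing of size $k$ for every $k$-assignment $L$ for $G$. *)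

theory Defs
  imports "Graph_Theory.Kuratowski"
begin

(* A simple graph is a loop-free symmetric digraph without parallel arcs (locale graph), so
   u and v are adjacent iff (u, v) is in arcs_ends G. *)

definition k_assignment :: "('a, 'b) pre_digraph \<Rightarrow> nat \<Rightarrow> ('a \<Rightarrow> 'c set) \<Rightarrow> bool" where
  "k_assignment G k L \<longleftrightarrow> (\<forall>v \<in> verts G. finite (L v) \<and> card (L v) = k)"

(* A coloring is a function on the vertex set only: it takes the value undefined elsewhere, so
   that distinct elements of a set of colorings are distinct as functions on verts G. *)
definition list_coloring :: "('a, 'b) pre_digraph \<Rightarrow> ('a \<Rightarrow> 'c set) \<Rightarrow> ('a \<Rightarrow> 'c) \<Rightarrow> bool" where
  "list_coloring G L f \<longleftrightarrow> f \<in> (\<Pi>\<^sub>E v \<in> verts G. L v)"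

definition proper_coloring :: "('a, 'b) pre_digraph \<Rightarrow> ('a \<Rightarrow> 'c) \<Rightarrow> bool" where
  "proper_coloring G f \<longleftrightarrow> (\<forall>u v. (u, v) \<in> arcs_ends G \<longrightarrow> f u \<noteq> f v)"

definition list_packing ::
  "('a, 'b) pre_digraph \<Rightarrow> ('a \<Rightarrow> 'c set) \<Rightarrow> nat \<Rightarrow> ('a \<Rightarrow> 'c) set \<Rightarrow> bool" where
  "list_packing G L k F \<longleftrightarrow>
     finite F \<and> card F = k \<and> (\<forall>f \<in> F. list_coloring G L f) \<and>
     (\<forall>f \<in> F. \<forall>g \<in> F. f \<noteq> g \<longrightarrow> (\<forall>v \<in> verts G. f v \<noteq> g v))"

definition proper_list_packing ::
  "('a, 'b) pre_digraph \<Rightarrow> ('a \<Rightarrow> 'c set) \<Rightarrow> nat \<Rightarrow> ('a \<Rightarrow> 'c) set \<Rightarrow> bool" where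
  "proper_list_packing G L k F \<longleftrightarrow> list_packing G L k F \<and> (\<forall>f \<in> F. proper_coloring G f)"

(* Colors are natural numbers; list_packable_any_colors below shows that lists over any other
   type give the same notion for finite graphs. *)
definition list_packable :: "('a, 'b) pre_digraph \<Rightarrow> nat \<Rightarrow> bool" where
  "list_packable G k \<longleftrightarrow>
     (\<forall>L :: 'a \<Rightarrow> nat set. k_assignment G k L \<longrightarrow> (\<exists>F. proper_list_packing G L k F))"

(* Only k \<ge> 1 is considered: the empty set is vacuously a proper packing of size 0. *)
definition list_packing_number :: "('a, 'b) pre_digraph \<Rightarrow> nat" where
  "list_packing_number G = (LEAST k. 1 \<le> k \<and> list_packable G k)"

lemma list_packable_any_colors:
  fixes G :: "('a, 'b) pre_digraph" and L :: "'a \<Rightarrow> 'c set"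
  assumes "graph G" and packable: "list_packable G k" and L: "k_assignment G k L"
  shows "\<exists>F. proper_list_packing G L k F"
proof -
  interpret graph G by fact
  define C where "C = (\<Union>v \<in> verts G. L v)"
  have LC: "L v \<subseteq> C" if "v \<in> verts G" for v
    using that by (auto simp: C_def)
  have "finite C"
    using L finite_verts by (auto simp: C_def k_assignment_def)
  then obtain h :: "'c \<Rightarrow> nat" where h: "inj_on h C"
    using finite_imp_inj_to_nat_seg by metis
  define e where "e = inv_into C h"
  have e: "e y \<in> L v" "h (e y) = y" if "v \<in> verts G" "y \<in> h ` L v" for v y
    using that LC[OF that(1)] h by (auto simp: e_def inv_into_f_f subset_iff)
  have "k_assignment G k (\<lambda>v. h ` L v)"
    using L LC h by (auto simp: k_assignment_def card_image inj_on_subset)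
  then obtain F where F: "proper_list_packing G (\<lambda>v. h ` L v) k F"
    using packable by (auto simp: list_packable_def)
  have Fin: "f v \<in> h ` L v" if "f \<in> F" "v \<in> verts G" for f v
    using F that by (auto simp: proper_list_packing_def list_packing_def list_coloring_def PiE_def)
  define t where "t f = restrict (\<lambda>v. e (f v)) (verts G)" for f
  have ht: "h (t f v) = f v" if "f \<in> F" "v \<in> verts G" for f v
    using e(2)[OF that(2) Fin[OF that]] that by (simp add: t_def)
  have "inj_on t F"
  proof (rule inj_onI)
    fix f g assume fg: "f \<in> F" "g \<in> F" and eq: "t f = t g"
    have "f \<in> extensional (verts G)" "g \<in> extensional (verts G)"
      using F fg by (auto simp: proper_list_packing_def list_packing_def list_coloring_def PiE_def)
    moreover have "f v = g v" if "v \<in> verts G" for v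
      using ht[OF fg(1) that] ht[OF fg(2) that] eq by simp
    ultimately show "f = g" by (rule extensionalityI)
  qed
  then have "proper_list_packing G L k (t ` F)"
  proof -
    have "list_coloring G L (t f)" if "f \<in> F" for f
      using e(1) Fin that by (auto simp: list_coloring_def t_def)
    moreover have "t f v \<noteq> t g v" if "f \<in> F" "g \<in> F" "t f \<noteq> t g" "v \<in> verts G" for f g v
    proof -
      have "f \<noteq> g" using that(3) by auto
      then have "f v \<noteq> g v"
        using F that by (auto simp: proper_list_packing_def list_packing_def)
      then show ?thesis using ht that by metis
    qed
    moreover have "proper_coloring G (t f)" if "f \<in> F" for f
      unfolding proper_coloring_def
    proof (intro allI impI)
      fix u v assume uv: "(u, v) \<in> arcs_ends G"
      then have "u \<in> verts G" "v \<in> verts G" by (auto simp: arcs_ends_conv)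
      moreover have "f u \<noteq> f v"
        using F that uv by (auto simp: proper_list_packing_def proper_coloring_def)
      ultimately show "t f u \<noteq> t f v" using ht that by metis
    qed
    ultimately show ?thesis
      using F \<open>inj_on t F\<close>
      by (auto simp: proper_list_packing_def list_packing_def card_image)
  qed
  then show ?thesis ..
qed

end

theory Submission
  imports Defs "HOL-Combinatorics.Transposition"
begin

text \<open>
  An \<open>n\<close>-assignment of \<open>K\<^sub>n\<close> is a bipartite graph between vertices and colors in which all vertices
  have degree \<open>n\<close> and all colors have degree at most \<open>n\<close>. A proper packing of size \<open>n\<close> is the same
  as a proper edge coloring of this graph with \<open>n\<close> indices, the edge \<open>vc\<close> having index \<open>i\<close> iff
  \<open>f\<^sub>i v = c\<close>. It exists by Koenig's edge coloring theorem, which is proved by adding the edges one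
  by one and swapping two indices along an alternating path. For the lower bound, identical lists
  of size less than \<open>n\<close> admit no proper coloring at all.
\<close>

text \<open>The relation \<open>E\<close> is the edge set of a bipartite graph whose sides are the
  two types; \<open>col\<close> is constrained on \<open>E\<close> only.\<close>

definition proper_edge_coloring :: "('a \<times> 'b) set \<Rightarrow> nat \<Rightarrow> ('a \<Rightarrow> 'b \<Rightarrow> nat) \<Rightarrow> bool" where
  "proper_edge_coloring E k col \<longleftrightarrow>
     (\<forall>(x, y) \<in> E. col x y < k) \<and>
     (\<forall>x. inj_on (col x) (E `` {x})) \<and>
     (\<forall>y. inj_on (\<lambda>x. col x y) (E\<inverse> `` {y}))"

lemma ex_missing_index:
  assumes "finite A" "card A < k"
  shows "\<exists>a<k. a \<notin> h ` A"
proof (rule ccontr)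
  assume "\<not> ?thesis"
  then have "{..<k} \<subseteq> h ` A" by auto
  then have "k \<le> card (h ` A)"
    using card_mono[of "h ` A" "{..<k}"] assms(1) by simp
  then show False
    using card_image_le[OF assms(1), of h] assms(2) by linarith
qed

text \<open>Swap \<open>a\<close> and \<open>b\<close> along the alternating path from
  \<open>v\<close> that starts with index \<open>a\<close>. The path enters vertices on the side of
  \<open>u\<close> by edges of index \<open>a\<close>, so it never meets \<open>u\<close>.
  Afterwards \<open>a\<close> is free at both ends and can be given to the new edge.\<close>

lemma proper_edge_coloring_insert:
  assumes col: "proper_edge_coloring E k col"
    and a: "a < k" "a \<notin> col u ` (E `` {u})"
    and b: "b < k" "b \<notin> (\<lambda>x. col x v) ` (E\<inverse> `` {v})"
  shows "\<exists>col'. proper_edge_coloring (insert (u, v) E) k col'"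
proof -
  have lt: "col x y < k" if "(x, y) \<in> E" for x y
    using col that by (auto simp: proper_edge_coloring_def)
  have row: "y = y'" if "(x, y) \<in> E" "(x, y') \<in> E" "col x y = col x y'" for x y y'
    using col that by (auto simp: proper_edge_coloring_def inj_on_def)
  have column: "x = x'" if "(x, y) \<in> E" "(x', y) \<in> E" "col x y = col x' y" for x x' y
    using col that by (auto simp: proper_edge_coloring_def inj_on_def)
  have ua: "col u y \<noteq> a" if "(u, y) \<in> E" for y
    using a(2) that by auto
  have vb: "col x v \<noteq> b" if "(x, v) \<in> E" for x
    using b(2) that by auto
  \<comment> \<open>One step of the path crosses a vertex \<open>x\<close>, entering by index
    \<open>a\<close> and leaving by index \<open>b\<close>.\<close>
  define R where
    "R = {(y, y'). \<exists>x. (x, y) \<in> E \<and> (x, y') \<in> E \<and> col x y = a \<and> col x y' = b}"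
  \<comment> \<open>the endpoints, on the side of \<open>v\<close>, of the path from \<open>v\<close> alternating between \<open>a\<close> and \<open>b\<close>\<close>
  define Q where "Q = R\<^sup>* `` {v}"
  have vQ: "v \<in> Q" by (simp add: Q_def)
  \<comment> \<open>As \<open>b\<close> is free at \<open>v\<close>, such a \<open>y\<close> was
    reached by a step ending in an edge of index \<open>b\<close>. By \<open>column\<close> that
    edge is \<open>(x, y)\<close>, so the step crossed \<open>x\<close>.\<close>
  have pred: "\<exists>y0 \<in> Q. (x, y0) \<in> E \<and> col x y0 = a"
    if "(x, y) \<in> E" "y \<in> Q" "col x y = b" for x y
  proof -
    have "(v, y) \<in> R\<^sup>*" "y \<noteq> v" using that vb by (auto simp: Q_def)
    then obtain y0 where "(v, y0) \<in> R\<^sup>*" "(y0, y) \<in> R"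
      by (metis rtranclE)
    then show ?thesis
      using that column unfolding R_def Q_def by fastforce
  qed
  have closed: "y' \<in> Q"
    if "(x, y) \<in> E" "(x, y') \<in> E" "y \<in> Q" "col x y \<in> {a, b}" "col x y' \<in> {a, b}" for x y y'
  proof -
    have "\<exists>y0 \<in> Q. (x, y0) \<in> E \<and> col x y0 = a"
      using that(1,3,4) pred by blast
    then obtain y0 where y0: "y0 \<in> Q" "(x, y0) \<in> E" "col x y0 = a"
      by blast
    show ?thesis
    proof (cases "col x y' = a")
      case True
      then show ?thesis using y0 row that by metis
    next
      case False
      then have "(y0, y') \<in> R" using y0 that by (auto simp: R_def)
      then show ?thesis using y0 by (auto simp: Q_def)
    qed
  qed
  \<comment> \<open>By \<open>closed\<close>, the edges of index \<open>a\<close> or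
    \<open>b\<close> at a given \<open>x\<close> end all inside or all outside \<open>Q\<close>.
    Hence the end \<open>y\<close> alone can decide whether an edge is swapped.\<close>
  define sw where "sw y = (if y \<in> Q then transpose a b else id)" for y
  define col' where "col' x y = (if (x, y) = (u, v) then a else sw y (col x y))" for x y
  have inj_sw: "sw y i = sw y j \<longleftrightarrow> i = j" for y i j
    by (auto simp: sw_def transpose_def)
  have sw_lt: "sw y i < k" if "i < k" for y i
    using a b that by (simp add: sw_def transpose_def)
  \<comment> \<open>A new index \<open>a\<close> at \<open>u\<close> would come from an edge of
    index \<open>b\<close> into \<open>Q\<close>, and then \<open>pred\<close> would give an old
    edge of index \<open>a\<close> at \<open>u\<close>.\<close>
  have sw_ua: "sw y (col u y) \<noteq> a" if "(u, y) \<in> E" for y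
    using that pred[OF that] ua by (auto simp: sw_def transpose_def)
  have sw_va: "sw v (col x v) \<noteq> a" if "(x, v) \<in> E" for x
    using that vb vQ by (auto simp: sw_def transpose_def)
  have sw_row: "y = y'"
    if "(x, y) \<in> E" "(x, y') \<in> E" "sw y (col x y) = sw y' (col x y')" for x y y'
  proof (cases "y \<in> Q \<longleftrightarrow> y' \<in> Q")
    case True
    then have "sw y = sw y'" by (simp add: sw_def)
    then show ?thesis using that inj_sw row by metis
  next
    \<comment> \<open>If only one end is in \<open>Q\<close>, equal new indices in
      {\<open>a\<close>, \<open>b\<close>} contradict \<open>closed\<close>; any other index was not
      changed by the swap, so \<open>row\<close> applies.\<close>
    case False
    then show ?thesis
      using that closed[of x y y'] closed[of x y' y] row[of x y y']
      by (auto simp: sw_def transpose_def split: if_splits)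
  qed
  have "proper_edge_coloring (insert (u, v) E) k col'"
    unfolding proper_edge_coloring_def
  proof (intro conjI allI)
    show "\<forall>(x, y) \<in> insert (u, v) E. col' x y < k"
      using a(1) lt sw_lt by (auto simp: col'_def)
    show "inj_on (col' x) (insert (u, v) E `` {x})" for x
      using sw_row sw_ua by (auto simp: inj_on_def col'_def)
    show "inj_on (\<lambda>x. col' x y) ((insert (u, v) E)\<inverse> `` {y})" for y
      using column sw_va by (auto simp: inj_on_def col'_def inj_sw)
  qed
  then show ?thesis by blast
qed

theorem koenig_edge_coloring:
  assumes "finite E"
    and "\<And>x. card (E `` {x}) \<le> k" and "\<And>y. card (E\<inverse> `` {y}) \<le> k"
  shows "\<exists>col. proper_edge_coloring E k col"
  using assms
proof (induction E rule: finite_induct)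
  case empty
  then show ?case by (simp add: proper_edge_coloring_def)
next
  case (insert e E)
  obtain u v where e: "e = (u, v)" by fastforce
  have fin: "finite (E `` {x})" "finite (E\<inverse> `` {y})" for x y
    using insert.hyps(1) by (auto simp: finite_Image)
  have rows: "insert e E `` {x} = (if x = u then insert v (E `` {x}) else E `` {x})" for x
    by (auto simp: e)
  have columns: "(insert e E)\<inverse> `` {y} = (if y = v then insert u (E\<inverse> `` {y}) else E\<inverse> `` {y})" for y
    by (auto simp: e)
  have "card (E `` {x}) \<le> k" for x
    using insert.prems(1)[of x] card_insert_le[of "E `` {x}" v]
    by (auto simp: rows split: if_splits)
  moreover have "card (E\<inverse> `` {y}) \<le> k" for y
    using insert.prems(2)[of y] card_insert_le[of "E\<inverse> `` {y}" u]
    by (auto simp: columns split: if_splits)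
  ultimately obtain col where col: "proper_edge_coloring E k col"
    using insert.IH by blast
  \<comment> \<open>The degree bounds hold with the new edge included, so without it both ends miss
    an index.\<close>
  have "card (E `` {u}) < k"
    using insert.prems(1)[of u] insert.hyps(2) fin unfolding rows by (simp add: e)
  then obtain a where a: "a < k" "a \<notin> col u ` (E `` {u})"
    using ex_missing_index[OF fin(1)] by blast
  have "card (E\<inverse> `` {v}) < k"
    using insert.prems(2)[of v] insert.hyps(2) fin unfolding columns by (simp add: e)
  then obtain b where b: "b < k" "b \<notin> (\<lambda>x. col x v) ` (E\<inverse> `` {v})"
    using ex_missing_index[OF fin(2)] by blast
  show ?case
    using proper_edge_coloring_insert[OF col a b] by (simp add: e)
qed

lemma complete_digraph_list_packable:
  assumes "n \<ge> 1" and G: "complete_digraph n G"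
  shows "list_packable G n"
  unfolding list_packable_def
proof (intro allI impI)
  fix L :: "'a \<Rightarrow> nat set"
  assume L: "k_assignment G n L"
  interpret graph G using G by (simp add: complete_digraph_def)
  have card_V: "card (verts G) = n"
    and arcs: "arcs_ends G = {(u, v). (u, v) \<in> verts G \<times> verts G \<and> u \<noteq> v}"
    using G by (auto simp: complete_digraph_def)
  have L': "finite (L v)" "card (L v) = n" if "v \<in> verts G" for v
    using L that by (auto simp: k_assignment_def)
  define E where "E = Sigma (verts G) L"
  have row: "E `` {v} = (if v \<in> verts G then L v else {})" for v
    by (auto simp: E_def)
  have "card (E\<inverse> `` {c}) \<le> n" for c
    using card_mono[of "verts G" "E\<inverse> `` {c}"] by (auto simp: E_def card_V)
  moreover have "card (E `` {v}) \<le> n" for v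
    using L' by (simp add: row)
  moreover have "finite E"
    using L' by (simp add: E_def)
  ultimately obtain col where col: "proper_edge_coloring E n col"
    using koenig_edge_coloring by metis
  \<comment> \<open>The list has exactly \<open>n\<close> colors, so each of the \<open>n\<close>
    indices occurs exactly once at \<open>v\<close> and every \<open>f i\<close> is defined
    there.\<close>
  have bij: "bij_betw (col v) (L v) {..<n}" if v: "v \<in> verts G" for v
  proof -
    have "inj_on (col v) (L v)"
      using col v row[of v] unfolding proper_edge_coloring_def by metis
    moreover from this have "col v ` L v = {..<n}"
      using col v L'[OF v]
      by (intro card_subset_eq) (auto simp: proper_edge_coloring_def E_def card_image)
    ultimately show ?thesis by (simp add: bij_betw_def)
  qed
  define f where "f i = restrict (\<lambda>v. inv_into (L v) (col v) i) (verts G)" for i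
  have f_in: "f i v \<in> L v" and col_f: "col v (f i v) = i" if "i < n" "v \<in> verts G" for i v
    using that bij[OF that(2)] by (auto simp: f_def bij_betw_def inv_into_into f_inv_into_f)
  \<comment> \<open>At any vertex \<open>v\<close>, \<open>col v\<close> recovers \<open>i\<close>
    from \<open>f i\<close>; without vertices all \<open>f i\<close> would coincide.\<close>
  have "verts G \<noteq> {}"
    using card_V assms(1) by auto
  then have "inj_on f {..<n}"
    using col_f by (metis ex_in_conv inj_onI lessThan_iff)
  then have "card (f ` {..<n}) = n"
    by (simp add: card_image)
  moreover have "list_coloring G L (f i)" if "i < n" for i
    using f_in[OF that] by (auto simp: list_coloring_def f_def)
  moreover have "f i v \<noteq> f j v" if "i < n" "j < n" "f i \<noteq> f j" "v \<in> verts G" for i j v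
    using that col_f by metis
  moreover have "proper_coloring G (f i)" if i: "i < n" for i
    unfolding proper_coloring_def
  proof (intro allI impI notI)
    fix u v assume uv: "(u, v) \<in> arcs_ends G" and eq: "f i u = f i v"
    then have V: "u \<in> verts G" "v \<in> verts G" "u \<noteq> v" by (auto simp: arcs)
    \<comment> \<open>Otherwise two edges at the color \<open>f i u\<close> would share the index
      \<open>i\<close>.\<close>
    have "inj_on (\<lambda>x. col x (f i u)) (E\<inverse> `` {f i u})"
      using col by (simp add: proper_edge_coloring_def)
    moreover have "u \<in> E\<inverse> `` {f i u}" "v \<in> E\<inverse> `` {f i u}"
      using V f_in[OF i V(1)] f_in[OF i V(2)] eq by (auto simp: E_def)
    moreover have "col u (f i u) = col v (f i u)"
      using col_f[OF i] V eq by metis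
    ultimately show False
      using V(3) by (auto dest: inj_onD)
  qed
  ultimately have "proper_list_packing G L n (f ` {..<n})"
    by (auto simp: proper_list_packing_def list_packing_def)
  then show "\<exists>F. proper_list_packing G L n F" ..
qed

lemma complete_digraph_list_packable_ge:
  assumes G: "complete_digraph n G" and "1 \<le> k" and "list_packable G k"
  shows "n \<le> k"
proof -
  have "k_assignment G k (\<lambda>_. {..<k})"
    by (simp add: k_assignment_def)
  then obtain F where F: "proper_list_packing G (\<lambda>_. {..<k}) k F"
    using assms(3) by (auto simp: list_packable_def)
  \<comment> \<open>Here \<open>1 \<le> k\<close> enters: the packing must contain a
    coloring.\<close>
  moreover from this have "F \<noteq> {}"
    using assms(2) by (auto simp: proper_list_packing_def list_packing_def)
  ultimately obtain f where f: "list_coloring G (\<lambda>_. {..<k}) f" "proper_coloring G f"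
    unfolding proper_list_packing_def list_packing_def by blast
  have "inj_on f (verts G)"
    using f(2) G by (auto simp: inj_on_def proper_coloring_def complete_digraph_def)
  moreover have "f ` verts G \<subseteq> {..<k}"
    using f(1) by (auto simp: list_coloring_def)
  ultimately have "card (verts G) \<le> k"
    using card_inj_on_le[of f "verts G" "{..<k}"] by simp
  then show ?thesis
    using G by (simp add: complete_digraph_def)
qed

theorem theorem3:
  fixes G :: "('a, 'b) pre_digraph" and n :: nat
  assumes "n \<ge> 1" and "complete_digraph n G"
  shows "list_packing_number G = n"
  unfolding list_packing_number_def
  using assms complete_digraph_list_packable complete_digraph_list_packable_ge
  by (intro Least_equality) auto

end
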